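(* Let $\mathbb{F}_q$ be a finite field of order $q=p^s$ with $p$ prime. Let $P_1,\dots,P_r \in \mathbb{F}_q[t_1,\dots,t_n]$ be nonzero polynomials, and let $\mathcal{I}\subseteq\{1,\dots,n\}$ be a nonempty subset such that $\max_{1\le j\le r}w_{p,\mathcal{I}}(P_j)>0$. Let $f_1,\dots,f_n \in \mathbb{F}_q[t]$ and assume that $f_i$ is nonconstant for all $i\in\mathcal{I}$. Suppose that $\sum_{j=1}^r w_{p,\mathcal{I}}(P_j) \le \sum_{i\in\mathcal{I}}\frac{1}{w_p(f_i)}$. Then \[ p^{\left\lceil s\left(\sum_{i\in\mathcal{I}}\frac{1}{w_p(f_i)}-\sum_{j=1}^r w_{p,\mathcal{I}}(P_j)\right)/\max_{1\le j\le r} w_{p,\mathcal{I}}(P_j)\right\rceil} \] divides $\# \{ (x_1,\dots,x_n) \in \mathbb{F}_q^n \mid P_j(f_1(x_1),\dots,f_n(x_n)) = 0 \text{ for all } 1 \leq j \leq r\}$.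
   Context: For integers $M\ge 0$ and $N\ge 2$, $\sigma_N(M)$ is the sum of the digits of $M$ in base $N$ (so $\sigma_N(0)=0$). For nonempty $\mathcal{I}\subseteq\{1,\dots,n\}$ and a monomial $a t_1^{m_1}\cdots t_n^{m_n}$ with $a\neq 0$, set $w_{p,\mathcal{I}}(a t_1^{m_1}\cdots t_n^{m_n})=\sum_{i\in\mathcal{I}}\sigma_p(m_i)$; for a polynomial $P$ that is a sum of monomials $Q_1,\dots,Q_\ell$ (its monomial terms), $w_{p,\mathcal{I}}(P)=\max_k w_{p,\mathcal{I}}(Q_k)$. For a univariate polynomial $f=\sum_\ell b_\ell t^{m_\ell}$ ($b_\ell\neq0$), $w_p(f)=\max_\ell \sigma_p(m_\ell)$. *)

theory Defs
  imports Complex_Main "HOL-Library.Cardinality" "HOL-Library.Poly_Mapping" "HOL-Computational_Algebra.Polynomial"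
    "HOL-Computational_Algebra.Primes"
begin

function digit_sum :: "nat \<Rightarrow> nat \<Rightarrow> nat" where
  "digit_sum N M = (if N < 2 \<or> M = 0 then 0 else M mod N + digit_sum N (M div N))"
  by auto
termination
  by (relation "measure snd") auto

declare digit_sum.simps [simp del]

text \<open>
  A polynomial over \<open>'a\<close> in variables indexed by the finite type \<open>'n\<close> is a finitely supported
  map from exponent vectors \<open>'n \<Rightarrow>\<^sub>0 nat\<close> to coefficients; \<open>keys P\<close> are the exponent vectors of
  the monomial terms of \<open>P\<close>. The ring structure is that of \<open>Poly_Mapping\<close>.
\<close>
type_synonym ('n, 'a) mvpoly = "('n \<Rightarrow>\<^sub>0 nat) \<Rightarrow>\<^sub>0 'a"

definition mvpoly_eval :: "('n::finite, 'a::comm_semiring_1) mvpoly \<Rightarrow> ('n \<Rightarrow> 'a) \<Rightarrow> 'a" where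
  "mvpoly_eval P x =
     (\<Sum>m\<in>Poly_Mapping.keys P. Poly_Mapping.lookup P m * (\<Prod>i\<in>UNIV. x i ^ Poly_Mapping.lookup m i))"

definition monom_weight :: "nat \<Rightarrow> 'n set \<Rightarrow> ('n \<Rightarrow>\<^sub>0 nat) \<Rightarrow> nat" where
  "monom_weight p I m = (\<Sum>i\<in>I. digit_sum p (Poly_Mapping.lookup m i))"

text \<open>The following two weights are meaningful for nonzero polynomials only.\<close>

definition mvpoly_weight :: "nat \<Rightarrow> 'n set \<Rightarrow> ('n, 'a::zero) mvpoly \<Rightarrow> nat" where
  "mvpoly_weight p I P = (MAX m\<in>Poly_Mapping.keys P. monom_weight p I m)"

definition poly_weight :: "nat \<Rightarrow> 'a::zero poly \<Rightarrow> nat" where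
  "poly_weight p f = (MAX m\<in>{m. coeff f m \<noteq> 0}. digit_sum p m)"

end

theory Submission
  imports Defs "HOL-Library.Multiset"
begin

text \<open>
  Give a difference operator \<open>\<Delta>\<close> in the \<open>i\<close>-th coordinate (\<open>i \<in> I\<close>) the weight \<open>\<omega> i = 1 / w\<^sub>p(f\<^sub>i)\<close>.
  Since the Frobenius map is additive, iterated differences of total weight above \<open>w\<^sub>p\<^sub>,\<^sub>I(P\<^sub>j)\<close> kill
  \<open>g\<^sub>j = P\<^sub>j(f\<^sub>1(x\<^sub>1), \<dots>, f\<^sub>n(x\<^sub>n))\<close>. Passing to the integral group ring of the additive group of the
  field, whose augmentation ideal \<open>J\<close> satisfies \<open>J\<^sup>m \<subseteq> p J\<^sup>m\<^sup>-\<^sup>p\<^sup>+\<^sup>1\<close> for \<open>m > (p - 1) s\<close>, one finds that the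
  integer-valued indicator of \<open>g\<^sub>j = 0\<close> has differences whose divisibility by \<open>p\<close> grows linearly
  with the weight. This decay is stable under products, and summing over a line
  \<open>x, x + a, \<dots>, x + (p - 1) a\<close> is the operator \<open>\<Delta>\<^sup>p\<^sup>-\<^sup>1\<close> plus \<open>p\<close> times a polynomial in \<open>\<Delta>\<close>, so each
  such summation improves the decay by \<open>\<omega> i\<close>. Summing over all \<open>s |I|\<close> lines of a basis yields the bound.
\<close>

section \<open>Weighted differences\<close>

text \<open>A direction pairs a coordinate with an increment. The weak sorts let one operator act on
  field-valued, group-ring-valued and integer-valued functions.\<close>

definition pdiff :: "'n \<times> 'a \<Rightarrow> (('n \<Rightarrow> 'a::plus) \<Rightarrow> 'b::minus) \<Rightarrow> ('n \<Rightarrow> 'a) \<Rightarrow> 'b" where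
  "pdiff d F x = F (x(fst d := x (fst d) + snd d)) - F x"

definition pdiffs :: "('n \<times> 'a) list \<Rightarrow> (('n \<Rightarrow> 'a::plus) \<Rightarrow> 'b::minus) \<Rightarrow> ('n \<Rightarrow> 'a) \<Rightarrow> 'b" where
  "pdiffs D F = foldr pdiff D F"

lemma pdiffs_Nil [simp]: "pdiffs [] F = F"
  by (simp add: pdiffs_def)

lemma pdiffs_append: "pdiffs (D @ D') F = pdiffs D (pdiffs D' F)"
  by (simp add: pdiffs_def)

lemma pdiffs_Cons: "pdiffs (d # D) F = pdiff d (pdiffs D F)"
  by (simp add: pdiffs_def)

lemma pdiffs_snoc: "pdiffs (D @ [d]) F = pdiffs D (pdiff d F)"
  by (simp add: pdiffs_def)

text \<open>Serves for constant multiples, for the \<open>p\<close>-th power map in characteristic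
  \<open>p\<close>, and for taking a coefficient in a group ring.\<close>

lemma pdiffs_additive:
  assumes "\<And>u v. \<phi> (u - v) = \<phi> u - \<phi> v"
  shows "pdiffs D (\<lambda>x. \<phi> (F x)) x = \<phi> (pdiffs D F x)"
  by (induction D arbitrary: x) (simp_all add: pdiffs_Cons pdiff_def assms)

lemma pdiffs_add:
  fixes F G :: "('n \<Rightarrow> 'a::plus) \<Rightarrow> 'b::ab_group_add"
  shows "pdiffs D (\<lambda>x. F x + G x) x = pdiffs D F x + pdiffs D G x"
  by (induction D arbitrary: x) (simp_all add: pdiffs_Cons pdiff_def)

lemma pdiffs_cmult:
  fixes F :: "('n \<Rightarrow> 'a::plus) \<Rightarrow> 'b::ring"
  shows "pdiffs D (\<lambda>x. c * F x) x = c * pdiffs D F x"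
  by (rule pdiffs_additive) (simp add: right_diff_distrib)

lemma pdiffs_zero [simp]:
  fixes x :: "'n \<Rightarrow> 'a::plus"
  shows "pdiffs D (\<lambda>x. 0) x = (0 :: 'b::ab_group_add)"
  by (induction D arbitrary: x) (simp_all add: pdiffs_Cons pdiff_def)

lemma pdiffs_sum:
  fixes F :: "'i \<Rightarrow> ('n \<Rightarrow> 'a::plus) \<Rightarrow> 'b::ab_group_add"
  shows "pdiffs D (\<lambda>x. \<Sum>i\<in>A. F i x) x = (\<Sum>i\<in>A. pdiffs D (F i) x)"
  by (induction A rule: infinite_finite_induct) (simp_all add: pdiffs_add)

lemma pdiffs_fun_upd_invariant:
  fixes F :: "('n \<Rightarrow> 'a::plus) \<Rightarrow> 'b::ab_group_add"
  assumes "\<And>i a x. i \<in> fst ` set D \<Longrightarrow> F (x(i := a)) = F x" and "D \<noteq> []"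
  shows "pdiffs D F x = 0"
proof (cases D rule: rev_cases)
  case (snoc D' d)
  with assms(1) have "pdiff d F = (\<lambda>x. 0)"
    by (simp add: pdiff_def fun_eq_iff)
  with snoc show ?thesis
    by (simp add: pdiffs_snoc)
qed (use assms in auto)

section \<open>Weighted degree of a function\<close>

locale diff_weights =
  fixes I :: "'n set" and \<omega> :: "'n \<Rightarrow> real"
  assumes weight_pos: "i \<in> I \<Longrightarrow> \<omega> i > 0"
begin

definition dirs :: "('n \<times> 'a) list set" where
  "dirs = lists (I \<times> UNIV)"

definition W :: "('n \<times> 'a) list \<Rightarrow> real" where
  "W D = (\<Sum>d\<leftarrow>D. \<omega> (fst d))"

lemma W_simps [simp]:
  "W [] = 0" "W (d # D) = \<omega> (fst d) + W D" "W (D @ D') = W D + W D'"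
  "W (replicate k d) = real k * \<omega> (fst d)"
  by (simp_all add: W_def sum_list_replicate)

lemma dirs_simps [simp]:
  "[] \<in> dirs" "d # D \<in> dirs \<longleftrightarrow> fst d \<in> I \<and> D \<in> dirs" "D @ D' \<in> dirs \<longleftrightarrow> D \<in> dirs \<and> D' \<in> dirs"
  by (cases d; auto simp: dirs_def)+

lemma dirs_replicate: "fst d \<in> I \<Longrightarrow> replicate k d \<in> dirs"
  by (induction k) auto

lemma W_nonneg: "D \<in> dirs \<Longrightarrow> W D \<ge> 0"
proof (induction D)
  case (Cons d D)
  then show ?case using weight_pos[of "fst d"] by simp
qed simp

lemma W_pos: "D \<in> dirs \<Longrightarrow> D \<noteq> [] \<Longrightarrow> W D > 0"
  by (cases D) (use weight_pos in \<open>auto intro!: add_pos_nonneg W_nonneg\<close>)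

text \<open>Leibniz rule, as a membership principle: \<open>\<Delta>(FG) = \<Delta>F \<Delta>G + F \<Delta>G + \<Delta>F G\<close>, so every term of an iterated
  difference of \<open>FG\<close> distributes all the directions to the two factors.\<close>

lemma pdiffs_mult_mem:
  fixes F G :: "('n \<Rightarrow> 'a::plus) \<Rightarrow> 'b::comm_ring_1"
  assumes "\<And>u v. u \<in> Z \<Longrightarrow> v \<in> Z \<Longrightarrow> u + v \<in> Z" and "D \<in> dirs"
    and "\<And>D1 D2. D1 \<in> dirs \<Longrightarrow> D2 \<in> dirs \<Longrightarrow> length D1 \<le> length D \<Longrightarrow> length D2 \<le> length D
           \<Longrightarrow> W D \<le> W D1 + W D2 \<Longrightarrow> pdiffs D1 F x * pdiffs D2 G x \<in> Z"
  shows "pdiffs D (\<lambda>x. F x * G x) x \<in> Z"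
  using assms(2,3)
proof (induction D arbitrary: F G rule: rev_induct)
  case Nil
  from Nil.prems(2)[of "[]" "[]"] show ?case by simp
next
  case (snoc d D)
  have d: "fst d \<in> I" "D \<in> dirs" and pos: "\<omega> (fst d) > 0"
    using snoc.prems(1) weight_pos by auto
  note hyp = snoc.prems(2)
  have "pdiff d (\<lambda>x. F x * G x)
      = (\<lambda>x. pdiff d F x * pdiff d G x + F x * pdiff d G x + pdiff d F x * G x)"
    by (auto simp: pdiff_def algebra_simps)
  then have "pdiffs (D @ [d]) (\<lambda>x. F x * G x) x
      = pdiffs D (\<lambda>x. pdiff d F x * pdiff d G x) x + pdiffs D (\<lambda>x. F x * pdiff d G x) x
        + pdiffs D (\<lambda>x. pdiff d F x * G x) x"
    by (simp add: pdiffs_snoc pdiffs_add)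
  moreover have "pdiffs D (\<lambda>x. pdiff d F x * pdiff d G x) x \<in> Z"
  proof (rule snoc.IH)
    fix D1 D2 :: "('n \<times> 'a) list"
    assume *: "D1 \<in> dirs" "D2 \<in> dirs" "length D1 \<le> length D" "length D2 \<le> length D" "W D \<le> W D1 + W D2"
    show "pdiffs D1 (pdiff d F) x * pdiffs D2 (pdiff d G) x \<in> Z"
      using hyp[of "D1 @ [d]" "D2 @ [d]"] * d pos by (simp add: pdiffs_snoc)
  qed fact
  moreover have "pdiffs D (\<lambda>x. F x * pdiff d G x) x \<in> Z"
  proof (rule snoc.IH)
    fix D1 D2 :: "('n \<times> 'a) list"
    assume *: "D1 \<in> dirs" "D2 \<in> dirs" "length D1 \<le> length D" "length D2 \<le> length D" "W D \<le> W D1 + W D2"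
    show "pdiffs D1 F x * pdiffs D2 (pdiff d G) x \<in> Z"
      using hyp[of "D1" "D2 @ [d]"] * d by (simp add: pdiffs_snoc)
  qed fact
  moreover have "pdiffs D (\<lambda>x. pdiff d F x * G x) x \<in> Z"
  proof (rule snoc.IH)
    fix D1 D2 :: "('n \<times> 'a) list"
    assume *: "D1 \<in> dirs" "D2 \<in> dirs" "length D1 \<le> length D" "length D2 \<le> length D" "W D \<le> W D1 + W D2"
    show "pdiffs D1 (pdiff d F) x * pdiffs D2 G x \<in> Z"
      using hyp[of "D1 @ [d]" "D2"] * d by (simp add: pdiffs_snoc)
  qed fact
  ultimately show ?case
    using assms(1) by simp
qed

text \<open>Degree is measured by vanishing differences rather than by monomials, so it makes sense
  for maps into any abelian group. A negative bound forces \<open>g\<close> to be zero, through the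
  empty list.\<close>

definition wdeg_le :: "real \<Rightarrow> (('n \<Rightarrow> 'a::plus) \<Rightarrow> 'b::ab_group_add) \<Rightarrow> bool" where
  "wdeg_le w g \<longleftrightarrow> (\<forall>D x. D \<in> dirs \<longrightarrow> w < W D \<longrightarrow> pdiffs D g x = 0)"

lemma wdeg_leD: "wdeg_le w g \<Longrightarrow> D \<in> dirs \<Longrightarrow> w < W D \<Longrightarrow> pdiffs D g x = 0"
  by (auto simp: wdeg_le_def)

lemma wdeg_le_mono: "wdeg_le w g \<Longrightarrow> w \<le> w' \<Longrightarrow> wdeg_le w' g"
  by (auto simp: wdeg_le_def)

lemma wdeg_le_invariant:
  fixes g :: "('n \<Rightarrow> 'a::plus) \<Rightarrow> 'b::ab_group_add"
  assumes "\<And>i a x. i \<in> I \<Longrightarrow> g (x(i := a)) = g x" and "w \<ge> 0"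
  shows "wdeg_le w g"
  unfolding wdeg_le_def
proof (intro allI impI)
  fix D :: "('n \<times> 'a) list" and x
  assume "D \<in> dirs" "w < W D"
  then show "pdiffs D g x = 0"
    using assms by (intro pdiffs_fun_upd_invariant) (auto simp: dirs_def)
qed

lemma wdeg_le_const: "w \<ge> 0 \<Longrightarrow> wdeg_le w (\<lambda>x. c)"
  by (rule wdeg_le_invariant) auto

text \<open>A difference in another coordinate kills \<open>x i\<close>, and one in coordinate
  \<open>i\<close> makes it constant. The strict inequality excludes a lone difference in coordinate
  \<open>i\<close>.\<close>

lemma wdeg_le_coord:
  fixes i :: 'n
  assumes "i \<in> I"
  shows "wdeg_le (\<omega> i) (\<lambda>x :: 'n \<Rightarrow> 'a::ab_group_add. x i)"
  unfolding wdeg_le_def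
proof (intro allI impI)
  fix D :: "('n \<times> 'a) list" and x :: "'n \<Rightarrow> 'a"
  assume D: "D \<in> dirs" "\<omega> i < W D"
  then obtain D' d where Dd: "D = D' @ [d]"
    using weight_pos[OF assms] by (cases D rule: rev_cases) auto
  have diff: "pdiff d (\<lambda>x. x i) = (\<lambda>x. if fst d = i then snd d else 0)"
    by (auto simp: pdiff_def fun_eq_iff)
  show "pdiffs D (\<lambda>x. x i) x = 0"
  proof (cases "fst d = i")
    case True
    then have "D' \<noteq> []" using D Dd by auto
    then show ?thesis
      using diff by (simp add: Dd pdiffs_snoc pdiffs_fun_upd_invariant)
  qed (simp add: Dd pdiffs_snoc diff)
qed

lemma wdeg_le_sum:
  assumes "\<And>i. i \<in> A \<Longrightarrow> wdeg_le w (F i)"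
  shows "wdeg_le w (\<lambda>x. \<Sum>i\<in>A. F i x)"
  using assms by (simp add: wdeg_le_def pdiffs_sum)

lemma wdeg_le_mult:
  fixes F G :: "('n \<Rightarrow> 'a::plus) \<Rightarrow> 'b::comm_ring_1"
  assumes F: "wdeg_le u F" and G: "wdeg_le v G"
  shows "wdeg_le (u + v) (\<lambda>x. F x * G x)"
  unfolding wdeg_le_def
proof (intro allI impI)
  fix D :: "('n \<times> 'a) list" and x
  assume D: "D \<in> dirs" "u + v < W D"
  have "pdiffs D (\<lambda>x. F x * G x) x \<in> {0}"
  proof (rule pdiffs_mult_mem)
    fix D1 D2 :: "('n \<times> 'a) list"
    assume *: "D1 \<in> dirs" "D2 \<in> dirs" "W D \<le> W D1 + W D2"
    then have "u < W D1 \<or> v < W D2" using D by linarith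
    then show "pdiffs D1 F x * pdiffs D2 G x \<in> {0}"
      using wdeg_leD[OF F *(1)] wdeg_leD[OF G *(2)] by auto
  qed (use D in auto)
  then show "pdiffs D (\<lambda>x. F x * G x) x = 0" by simp
qed

lemma wdeg_le_power:
  fixes F :: "('n \<Rightarrow> 'a::plus) \<Rightarrow> 'b::comm_ring_1"
  assumes "wdeg_le w F"
  shows "wdeg_le (w * real k) (\<lambda>x. F x ^ k)"
proof (induction k)
  case (Suc k)
  from wdeg_le_mult[OF assms Suc] show ?case by (simp add: algebra_simps)
qed (simp add: wdeg_le_const)

lemma wdeg_le_prod:
  fixes F :: "'i \<Rightarrow> ('n \<Rightarrow> 'a::plus) \<Rightarrow> 'b::comm_ring_1"
  assumes "finite A" "\<And>i. i \<in> A \<Longrightarrow> wdeg_le (w i) (F i)"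
  shows "wdeg_le (\<Sum>i\<in>A. w i) (\<lambda>x. \<Prod>i\<in>A. F i x)"
  using assms
proof (induction A rule: finite_induct)
  case (insert i A)
  then show ?case using wdeg_le_mult[of "w i" "F i"] by simp
qed (simp add: wdeg_le_const)

text \<open>Induction on base-\<open>p\<close> digits, from
  \<open>m = m mod p + m div p * p\<close>. Raising to the power \<open>p\<close> is additive, hence
  commutes with differences and leaves the bound unchanged; only the last digit adds to it.\<close>

lemma wdeg_le_power_digit_sum:
  fixes F :: "('n \<Rightarrow> 'a::plus) \<Rightarrow> 'b::comm_ring_1"
  assumes p: "prime p" "p = CHAR('b)" and F: "wdeg_le w F" and w: "w \<ge> 0"
  shows "wdeg_le (w * real (digit_sum p m)) (\<lambda>x. F x ^ m)"
proof (induction m rule: less_induct)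
  case (less m)
  have p2: "p \<ge> 2" using p(1) prime_ge_2_nat by blast
  show ?case
  proof (cases "m = 0")
    case False
    then have "m div p < m" using p2 by simp
    then have IH: "wdeg_le (w * real (digit_sum p (m div p))) (\<lambda>x. F x ^ (m div p))"
      by (rule less)
    have add: "(u - v) ^ p = u ^ p - v ^ p" for u v :: 'b
    proof -
      have "((u - v) + v) ^ p = (u - v) ^ p + v ^ p"
        using p by (intro freshmans_dream) auto
      then show ?thesis by simp
    qed
    have "wdeg_le (w * real (digit_sum p (m div p))) (\<lambda>x. (F x ^ (m div p)) ^ p)"
      using IH p2 by (auto simp: wdeg_le_def pdiffs_additive[where \<phi> = "\<lambda>u. u ^ p", OF add] power_0_left)
    from wdeg_le_mult[OF wdeg_le_power[OF F, of "m mod p"] this]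
    have "wdeg_le (w * real (m mod p) + w * real (digit_sum p (m div p)))
        (\<lambda>x. F x ^ (m mod p + m div p * p))"
      by (simp only: power_add power_mult)
    then show ?thesis
      using False p2 by (subst digit_sum.simps) (simp add: algebra_simps)
  qed (simp add: digit_sum.simps[of p 0] wdeg_le_const)
qed

lemma wdeg_le_pdiff:
  fixes g :: "('n \<Rightarrow> 'a::plus) \<Rightarrow> 'b::ab_group_add"
  assumes "wdeg_le w g" "fst d \<in> I"
  shows "wdeg_le (w - \<omega> (fst d)) (pdiff d g)"
  unfolding wdeg_le_def
proof (intro allI impI)
  fix D :: "('n \<times> 'a) list" and x
  assume "D \<in> dirs" "w - \<omega> (fst d) < W D"
  then show "pdiffs D (pdiff d g) x = 0"
    using wdeg_leD[OF assms(1), of "D @ [d]" x] assms(2) by (simp add: pdiffs_snoc)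
qed

end

section \<open>Powers of an ideal and composition with exponentials\<close>

text \<open>\<open>ideal_power Y m\<close> is the \<open>m\<close>-th power of the ideal generated by \<open>Y\<close>.\<close>

inductive_set ideal_power :: "'k::comm_ring_1 set \<Rightarrow> nat \<Rightarrow> 'k set" for Y m where
  zero: "0 \<in> ideal_power Y m"
| add: "z \<in> ideal_power Y m \<Longrightarrow> set_mset M \<subseteq> Y \<Longrightarrow> m \<le> size M \<Longrightarrow> c * prod_mset M + z \<in> ideal_power Y m"

lemma ideal_power_monomial: "set_mset M \<subseteq> Y \<Longrightarrow> m \<le> size M \<Longrightarrow> c * prod_mset M \<in> ideal_power Y m"
  using ideal_power.add[OF ideal_power.zero, of M Y m c] by simp

lemma ideal_power_add: "u \<in> ideal_power Y m \<Longrightarrow> v \<in> ideal_power Y m \<Longrightarrow> u + v \<in> ideal_power Y m"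
  by (induction rule: ideal_power.induct) (auto simp: add.assoc intro: ideal_power.add)

lemma ideal_power_cmult: "u \<in> ideal_power Y m \<Longrightarrow> c * u \<in> ideal_power Y m"
  by (induction rule: ideal_power.induct) (auto simp: distrib_left mult.assoc[symmetric] intro: ideal_power.intros)

lemma ideal_power_antimono: "u \<in> ideal_power Y m \<Longrightarrow> n \<le> m \<Longrightarrow> u \<in> ideal_power Y n"
  by (induction rule: ideal_power.induct) (auto intro: ideal_power.intros)

lemma ideal_power_0: "u \<in> ideal_power Y 0"
  using ideal_power_monomial[of "{#}" Y 0 u] by simp

lemma ideal_power_prod_mset_mult:
  assumes "v \<in> ideal_power Y n" "set_mset M \<subseteq> Y" "m \<le> size M"
  shows "prod_mset M * v \<in> ideal_power Y (m + n)"
  using assms(1)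
proof (induction rule: ideal_power.induct)
  case (add z N c)
  have "c * prod_mset (M + N) + prod_mset M * z \<in> ideal_power Y (m + n)"
    using add assms by (intro ideal_power.add) auto
  then show ?case by (simp add: algebra_simps)
qed (simp add: ideal_power.zero)

lemma ideal_power_mult:
  assumes "u \<in> ideal_power Y m" "v \<in> ideal_power Y n"
  shows "u * v \<in> ideal_power Y (m + n)"
  using assms(1)
proof (induction rule: ideal_power.induct)
  case (add z M c)
  have "c * (prod_mset M * v) + z * v \<in> ideal_power Y (m + n)"
    by (intro ideal_power_add ideal_power_cmult ideal_power_prod_mset_mult add assms)
  then show ?case by (simp add: algebra_simps)
qed (simp add: ideal_power.zero)

text \<open>Pigeonhole: a monomial of degree exceeding \<open>(p - 1) |Y|\<close> contains some \<open>y ^ p\<close>, which is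
  divisible by \<open>p y\<close>; one factor \<open>p\<close> is thus gained for every \<open>p - 1\<close> degrees.\<close>

lemma ideal_power_dvd:
  fixes Y :: "'k::comm_ring_1 set"
  assumes Y: "finite Y" "card Y \<le> s" and p: "p \<ge> 1"
    and y: "\<And>y. y \<in> Y \<Longrightarrow> of_nat p * y dvd y ^ p"
  shows "u \<in> ideal_power Y (Suc ((p - 1) * (s + c))) \<Longrightarrow> of_nat p ^ Suc c dvd u"
proof -
  \<comment> \<open>The bound says that \<open>size M\<close> exceeds
    \<open>(p - 1) * (s + k - 1)\<close>; moving \<open>p - 1\<close> to the right avoids truncated
    subtraction.\<close>
  have gain: "of_nat p ^ k dvd prod_mset M"
    if "set_mset M \<subseteq> Y" "(p - 1) * (s + k) < size M + (p - 1)" for M k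
    using that
  proof (induction k arbitrary: M)
    case (Suc k)
    have "\<exists>e\<in>set_mset M. p \<le> count M e"
    proof (rule ccontr)
      assume "\<not> ?thesis"
      then have "\<forall>e\<in>set_mset M. count M e \<le> p - 1" by force
      then have "size M \<le> card (set_mset M) * (p - 1)"
        unfolding size_multiset_overloaded_eq using sum_bounded_above by fastforce
      also have "\<dots> \<le> s * (p - 1)"
        using Y card_mono[OF Y(1) Suc.prems(1)] by (intro mult_right_mono) auto
      finally show False
        using Suc.prems(2) by (simp add: distrib_left mult.commute[of s])
    qed
    then obtain e where e: "e \<in> Y" "p \<le> count M e"
      using Suc.prems by blast
    define N where "N = M - replicate_mset p e"
    have M: "M = N + replicate_mset p e"
      using e by (simp add: N_def count_le_replicate_mset_subset_eq)
    \<comment> \<open>Trading \<open>p\<close> copies of \<open>e\<close> for one lowers the size by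
      \<open>p - 1\<close> and releases one factor \<open>p\<close>.\<close>
    define N' where "N' = add_mset e N"
    have "of_nat p ^ k dvd prod_mset N'"
    proof (rule Suc.IH)
      show "set_mset N' \<subseteq> Y"
        using Suc.prems(1) e by (auto simp: N'_def M)
      show "(p - 1) * (s + k) < size N' + (p - 1)"
        using Suc.prems(2) p by (simp add: N'_def M algebra_simps)
    qed
    then have "of_nat p * of_nat p ^ k dvd of_nat p * prod_mset N'"
      by (rule mult_dvd_mono[OF dvd_refl])
    then have "of_nat p ^ Suc k dvd prod_mset N * (of_nat p * e)"
      by (simp add: N'_def algebra_simps)
    also have "\<dots> dvd prod_mset N * e ^ p"
      using y[OF e(1)] by (rule mult_dvd_mono[OF dvd_refl])
    finally show ?case by (simp add: M)
  qed simp
  have mono: "of_nat p ^ Suc c dvd prod_mset M"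
    if "set_mset M \<subseteq> Y" "Suc ((p - 1) * (s + c)) \<le> size M" for M
    using gain[of M "Suc c"] that by (simp add: distrib_left)
  show "of_nat p ^ Suc c dvd u" if "u \<in> ideal_power Y (Suc ((p - 1) * (s + c)))"
    using that
  proof (induction rule: ideal_power.induct)
    case (add z M a)
    then show ?case using mono[of M] by (intro dvd_add dvd_mult) auto
  qed simp
qed

context diff_weights
begin

text \<open>Composition estimate. The key identity is
  \<open>\<Delta>\<^sub>d (\<epsilon> \<circ> g) = (\<epsilon> \<circ> g) ((\<epsilon> \<circ> \<Delta>\<^sub>d g) - 1)\<close>, in which \<open>\<Delta>\<^sub>d g\<close> has smaller weighted degree.\<close>

lemma pdiffs_exp_mem_ideal_power:
  fixes g :: "('n \<Rightarrow> 'a::plus) \<Rightarrow> 'b::ab_group_add" and \<epsilon> :: "'b \<Rightarrow> 'k::comm_ring_1"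
  assumes \<epsilon>: "\<And>a b. \<epsilon> (a + b) = \<epsilon> a * \<epsilon> b" "\<epsilon> 0 = 1" "\<And>a. \<epsilon> a - 1 \<in> ideal_power Y 1"
    and "wdeg_le w g" "D \<in> dirs" "w \<ge> 0" "real m * w < W D"
  shows "pdiffs D (\<lambda>x. \<epsilon> (g x)) x \<in> ideal_power Y (Suc m)"
  using assms(4-)
proof (induction "length D" arbitrary: D g w m x rule: less_induct)
  case less
  show ?case
  proof (cases D rule: rev_cases)
    case Nil
    then have False using less.prems by (simp add: mult_less_0_iff)
    then show ?thesis ..
  next
    case (snoc D' d)
    define o1 where "o1 = \<omega> (fst d)"
    have d: "fst d \<in> I" "D' \<in> dirs" and o1: "o1 > 0" and WD: "W D = W D' + o1"
      using less.prems weight_pos by (auto simp: snoc o1_def)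
    have deg: "wdeg_le (w - o1) (pdiff d g)"
      unfolding o1_def by (rule wdeg_le_pdiff) (use less.prems d in auto)
    have step: "\<epsilon> (u + v) - \<epsilon> u = \<epsilon> u * (\<epsilon> v - 1)" for u v
      by (simp add: \<epsilon>(1) algebra_simps)
    have fact1: "pdiff d (\<lambda>x. \<epsilon> (g x)) = (\<lambda>x. \<epsilon> (g x) * (\<epsilon> (pdiff d g x) - 1))"
      by (auto simp: pdiff_def step[symmetric])
    show ?thesis
    proof (cases "o1 > w")
      case True
      then have "pdiff d g y = 0" for y
        using wdeg_leD[OF deg, of "[]"] by simp
      then show ?thesis by (simp add: snoc pdiffs_snoc fact1 \<epsilon>(2) ideal_power.zero)
    next
      case False
      then have w: "w > 0" "o1 \<le> w" using o1 by auto
      have "pdiffs D' (\<lambda>x. \<epsilon> (g x) * (\<epsilon> (pdiff d g x) - 1)) x \<in> ideal_power Y (Suc m)"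
      proof (rule pdiffs_mult_mem)
        fix D1 D2 :: "('n \<times> 'a) list"
        assume *: "D1 \<in> dirs" "D2 \<in> dirs" "length D1 \<le> length D'" "length D2 \<le> length D'"
          "W D' \<le> W D1 + W D2"
        \<comment> \<open>The induction hypothesis, rounded up: \<open>k\<close> is the ceiling of
          \<open>W E / w'\<close>.\<close>
        have mem: "\<exists>k. v \<le> real k * w' \<and> pdiffs E (\<lambda>x. \<epsilon> (h x)) x \<in> ideal_power Y k"
          if "wdeg_le w' h" "E \<in> dirs" "length E \<le> length D'" "w' > 0" "v = W E"
          for E h w' v
        proof (cases "v = 0")
          case True
          then show ?thesis using ideal_power_0 by (intro exI[of _ 0]) auto
        next
          case False
          then have pos: "v > 0" using W_nonneg[OF that(2)] that by simp
          define k where "k = nat \<lceil>v / w'\<rceil>"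
          have "v / w' > 0" using pos that by simp
          then have k: "v / w' \<le> real k" "real k - 1 < v / w'" "k > 0"
            unfolding k_def by linarith+
          then have "real (k - 1) * w' < v" "v \<le> real k * w'"
            using that(4) by (simp_all add: field_simps of_nat_diff)
          then show ?thesis
            using less.hyps[of E w' h "k - 1" x] that k snoc by (intro exI[of _ k]) auto
        qed
        obtain k1 where k1: "W D1 \<le> real k1 * w" "pdiffs D1 (\<lambda>x. \<epsilon> (g x)) x \<in> ideal_power Y k1"
          using mem[of w g D1] less.prems * w by auto
        \<comment> \<open>\<open>k2\<close> must pay for \<open>W D2\<close> and also for the
          direction \<open>d\<close> spent on \<open>pdiff d g\<close>. If \<open>D2\<close> is
          empty, the subtracted 1 provides one ideal factor, which covers \<open>o1\<close> since
          \<open>o1 \<le> w\<close>.\<close>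
        obtain k2 where k2: "W D2 + o1 \<le> real k2 * w"
          "pdiffs D2 (\<lambda>x. \<epsilon> (pdiff d g x) - 1) x \<in> ideal_power Y k2"
        proof (cases "D2 = []")
          case True
          with \<epsilon>(3)[of "pdiff d g x"] w that[of 1] show thesis by auto
        next
          case ne: False
          have eq: "pdiffs D2 (\<lambda>x. \<epsilon> (pdiff d g x) - 1) x = pdiffs D2 (\<lambda>x. \<epsilon> (pdiff d g x)) x"
            using pdiffs_add[of D2 "\<lambda>x. \<epsilon> (pdiff d g x)" "\<lambda>_. -1" x]
              pdiffs_fun_upd_invariant[of D2 "\<lambda>_. -1" x] ne by simp
          have pos: "W D2 > 0" using W_pos * ne by blast
          show thesis
          \<comment> \<open>In this case \<open>pdiff d g\<close> has weighted degree at most 0, so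
            nonempty differences of its exponential lie in every power of the ideal, and any large
            \<open>k\<close> works.\<close>
          proof (cases "o1 = w")
            case True
            obtain k :: nat where k: "(W D2 + o1) / w \<le> real k"
              using real_arch_simple by blast
            have "pdiffs D2 (\<lambda>x. \<epsilon> (pdiff d g x)) x \<in> ideal_power Y (Suc k)"
              using less.hyps[of D2 0 "pdiff d g" k x] deg True * pos snoc by simp
            then have "pdiffs D2 (\<lambda>x. \<epsilon> (pdiff d g x)) x \<in> ideal_power Y k"
              by (rule ideal_power_antimono) simp
            then show thesis
              using that[of k] k w eq by (simp add: field_simps)
          next
            case False
            then obtain k where k: "W D2 \<le> real k * (w - o1)"
              "pdiffs D2 (\<lambda>x. \<epsilon> (pdiff d g x)) x \<in> ideal_power Y k"
              using mem[of "w - o1" "pdiff d g" D2] deg * w by auto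
            \<comment> \<open>This yields \<open>k * (w - o1) + o1 \<le> k * w\<close>, so the same
              \<open>k\<close> also pays for \<open>d\<close>.\<close>
            then have "k \<ge> 1" using pos by (cases k) auto
            then have "o1 \<le> real k * o1" using o1 by simp
            then show thesis
              using that[of k] k eq by (simp add: algebra_simps)
          qed
        qed
        have "real m * w < real (k1 + k2) * w"
          using less.prems(4) WD * k1(1) k2(1) by (simp add: algebra_simps)
        then have "Suc m \<le> k1 + k2" using w by simp
        then show "pdiffs D1 (\<lambda>x. \<epsilon> (g x)) x * pdiffs D2 (\<lambda>x. \<epsilon> (pdiff d g x) - 1) x \<in> ideal_power Y (Suc m)"
          by (rule ideal_power_antimono[OF ideal_power_mult[OF k1(2) k2(2)]])
      qed (use d ideal_power_add in auto)
      then show ?thesis by (simp add: snoc pdiffs_snoc fact1)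
    qed
  qed
qed

section \<open>Decay of differences\<close>

text \<open>\<open>R\<close> is the weight, in units of \<open>p - 1\<close>, beyond which the first factor \<open>p\<close> appears, and every
  further factor \<open>p\<close> costs \<open>M\<close> units.\<close>

definition decay :: "nat \<Rightarrow> real \<Rightarrow> real \<Rightarrow> (('n \<Rightarrow> 'a::plus) \<Rightarrow> int) \<Rightarrow> bool" where
  "decay p R M F \<longleftrightarrow> (\<forall>D x c. D \<in> dirs \<longrightarrow> real (p - 1) * (R + real c * M) < W D
      \<longrightarrow> int p ^ Suc c dvd pdiffs D F x)"

lemma decayD:
  "decay p R M F \<Longrightarrow> D \<in> dirs \<Longrightarrow> real (p - 1) * (R + real c * M) < W D \<Longrightarrow> int p ^ Suc c dvd pdiffs D F x"
  by (auto simp: decay_def)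

lemma decay_mono:
  assumes "decay p R M F" "M \<le> M'"
  shows "decay p R M' F"
  unfolding decay_def
proof (intro allI impI)
  fix D :: "('n \<times> 'a) list" and x c
  assume D: "D \<in> dirs" "real (p - 1) * (R + real c * M') < W D"
  have "real (p - 1) * (R + real c * M) \<le> real (p - 1) * (R + real c * M')"
    using assms by (intro mult_left_mono add_left_mono) auto
  then show "int p ^ Suc c dvd pdiffs D F x"
    using D decayD[OF assms(1)] by fastforce
qed

lemma decay_one: "M \<ge> 0 \<Longrightarrow> decay p 0 M (\<lambda>x. 1)"
  unfolding decay_def
proof (intro allI impI)
  fix D :: "('n \<times> 'a) list" and x c
  assume M: "M \<ge> 0" and D: "D \<in> dirs" "real (p - 1) * (0 + real c * M) < W D"
  then have "W D > 0" by (smt (verit) mult_nonneg_nonneg of_nat_0_le_iff)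
  then show "int p ^ Suc c dvd pdiffs D (\<lambda>x. 1) x"
    by (subst pdiffs_fun_upd_invariant) auto
qed

text \<open>For each factor of a Leibniz term take the least \<open>k\<close> whose threshold is not
  exceeded; decay at \<open>k - 1\<close> then gives \<open>p ^ k\<close>. As both factors share the
  cost \<open>M\<close>, their thresholds add and force \<open>k1 + k2 > c\<close>.\<close>

lemma decay_mult:
  fixes F G :: "('n \<Rightarrow> 'a::plus) \<Rightarrow> int"
  assumes F: "decay p R1 M F" and G: "decay p R2 M G" and p: "p > 1" and M: "M > 0"
  shows "decay p (R1 + R2) M (\<lambda>x. F x * G x)"
  unfolding decay_def
proof (intro allI impI)
  fix D :: "('n \<times> 'a) list" and x c
  assume D: "D \<in> dirs" "real (p - 1) * (R1 + R2 + real c * M) < W D"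
  have ex: "\<exists>k. W E \<le> real (p - 1) * (R + real k * M) \<and> int p ^ k dvd pdiffs E H x"
    if H: "decay p R M H" and E: "E \<in> dirs" for E R and H :: "('n \<Rightarrow> 'a) \<Rightarrow> int"
  proof -
    define Q where "Q k \<longleftrightarrow> W E \<le> real (p - 1) * (R + real k * M)" for k :: nat
    obtain k0 :: nat where "(W E / real (p - 1) - R) / M \<le> real k0"
      using real_arch_simple by blast
    then have "Q k0"
      using p M by (simp add: Q_def field_simps)
    then obtain k where Q: "Q k" and least: "\<And>k'. Q k' \<Longrightarrow> k \<le> k'"
      by (metis LeastI Least_le)
    have "int p ^ k dvd pdiffs E H x"
    proof (cases k)
      case (Suc k')
      then have "\<not> Q k'" using least[of k'] by auto
      then show ?thesis
        using decayD[OF H E, of k' x] by (simp add: Suc Q_def)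
    qed simp
    with Q show ?thesis unfolding Q_def by blast
  qed
  have "pdiffs D (\<lambda>x. F x * G x) x \<in> {z. int p ^ Suc c dvd z}"
  proof (rule pdiffs_mult_mem)
    fix D1 D2 :: "('n \<times> 'a) list"
    assume *: "D1 \<in> dirs" "D2 \<in> dirs" "W D \<le> W D1 + W D2"
    obtain k1 where k1: "W D1 \<le> real (p - 1) * (R1 + real k1 * M)" "int p ^ k1 dvd pdiffs D1 F x"
      using ex[OF F *(1)] by blast
    obtain k2 where k2: "W D2 \<le> real (p - 1) * (R2 + real k2 * M)" "int p ^ k2 dvd pdiffs D2 G x"
      using ex[OF G *(2)] by blast
    have "real (p - 1) * (R1 + R2 + real c * M)
        < real (p - 1) * (R1 + real k1 * M) + real (p - 1) * (R2 + real k2 * M)"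
      using D(2) *(3) k1(1) k2(1) by linarith
    also have "\<dots> = real (p - 1) * (R1 + R2 + real (k1 + k2) * M)"
      by (simp add: algebra_simps)
    finally have "Suc c \<le> k1 + k2"
      using p M by simp
    then have "int p ^ Suc c dvd int p ^ (k1 + k2)" by (rule le_imp_power_dvd)
    also have "\<dots> dvd pdiffs D1 F x * pdiffs D2 G x"
      unfolding power_add using k1 k2 by (intro mult_dvd_mono)
    finally show "pdiffs D1 F x * pdiffs D2 G x \<in> {z. int p ^ Suc c dvd z}" by simp
  qed (use D in auto)
  then show "int p ^ Suc c dvd pdiffs D (\<lambda>x. F x * G x) x" by simp
qed

lemma decay_prod:
  fixes F :: "'i \<Rightarrow> ('n \<Rightarrow> 'a::plus) \<Rightarrow> int"
  assumes "finite A" "\<And>j. j \<in> A \<Longrightarrow> decay p (R j) M (F j)" and "p > 1" "M > 0"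
  shows "decay p (\<Sum>j\<in>A. R j) M (\<lambda>x. \<Prod>j\<in>A. F j x)"
  using assms
proof (induction A rule: finite_induct)
  case (insert j A)
  then show ?case using decay_mult[of p "R j" M "F j"] by simp
qed (simp add: decay_one)

end

text \<open>Expand \<open>(y + 1) ^ p = 1\<close> with \<open>y = z - 1\<close>: every middle
  binomial coefficient is divisible by \<open>p\<close>. Group elements of order dividing
  \<open>p\<close> thus satisfy the divisibility hypothesis of
  \<open>ideal_power_dvd\<close>.\<close>

lemma of_nat_prime_mult_dvd_power:
  fixes z :: "'k::comm_ring_1"
  assumes p: "prime p" and z: "z ^ p = 1"
  shows "of_nat p * (z - 1) dvd (z - 1) ^ p"
proof -
  define y where "y = z - 1"
  have p2: "p \<ge> 2" using p prime_ge_2_nat by blast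
  have "1 = (y + 1) ^ p" by (simp add: y_def z)
  also have "\<dots> = (\<Sum>k\<le>p. of_nat (p choose k) * y ^ k)"
    by (simp add: binomial_ring)
  also have "{..p} = insert 0 (insert p {1..<p})" using p2 by auto
  also have "(\<Sum>k\<in>\<dots>. of_nat (p choose k) * y ^ k)
      = 1 + (y ^ p + (\<Sum>k\<in>{1..<p}. of_nat (p choose k) * y ^ k))"
    using p2 by simp
  finally have *: "y ^ p = - (\<Sum>k\<in>{1..<p}. of_nat (p choose k) * y ^ k)"
    by (simp add: eq_neg_iff_add_eq_0)
  have "of_nat p * y dvd of_nat (p choose k) * y ^ k" if "k \<in> {1..<p}" for k
  proof (rule mult_dvd_mono)
    show "(of_nat p :: 'k) dvd of_nat (p choose k)"
    proof -
      have "p dvd (p choose k)" using that p by (intro dvd_choose_prime) auto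
      then show ?thesis by (auto elim!: dvdE)
    qed
    show "y dvd y ^ k" using that by (simp add: dvd_power)
  qed
  then have "of_nat p * y dvd y ^ p"
    unfolding * by (auto intro!: dvd_sum)
  then show ?thesis by (simp add: y_def)
qed

text \<open>\<open>es\<close> is a basis of \<open>H\<close> over the prime field.\<close>

inductive p_span :: "nat \<Rightarrow> 'a::comm_ring_1 list \<Rightarrow> 'a set \<Rightarrow> bool" for p where
  Nil: "p_span p [] {0}"
| Cons: "p_span p es H \<Longrightarrow> inj_on (\<lambda>(h, k). h + of_nat k * e) (H \<times> {..<p})
    \<Longrightarrow> p_span p (e # es) ((\<lambda>(h, k). h + of_nat k * e) ` (H \<times> {..<p}))"

lemma p_span_card: "p_span p es H \<Longrightarrow> card H = p ^ length es"
  by (induction rule: p_span.induct) (simp_all add: card_image card_cartesian_product)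

lemma p_span_subset:
  assumes "p_span p es H" "0 \<in> X" "\<And>a b. a \<in> X \<Longrightarrow> b \<in> X \<Longrightarrow> a + b \<in> X" "set es \<subseteq> X"
  shows "H \<subseteq> X"
  using assms(1,4)
proof (induction rule: p_span.induct)
  case (Cons es H e)
  have "of_nat k * e \<in> X" for k
    by (induction k) (use Cons.prems assms(2,3) in \<open>auto simp: distrib_right\<close>)
  then show ?case using Cons assms(3) by auto
qed (use assms in auto)

text \<open>A basis is chosen greedily: a span of fewer than \<open>s\<close> elements is too small
  to be everything, so some \<open>e\<close> lies outside it. Representations stay unique because a
  nonzero multiplier below \<open>p\<close> is invertible modulo \<open>p\<close>.\<close>

lemma ex_p_span:
  assumes p: "prime p" and char: "of_nat p = (0 :: 'a::{field,finite})" and card: "CARD('a) = p ^ s"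
  shows "\<exists>es. length es = s \<and> p_span p es (UNIV :: 'a set)"
proof -
  have p2: "p \<ge> 2" using p prime_ge_2_nat by blast
  have ofmod: "of_nat (k mod p) = (of_nat k :: 'a)" for k
    by (metis add_0 char mod_mult_div_eq mult_zero_left of_nat_add of_nat_mult add.right_neutral)
  have "t \<le> s \<Longrightarrow> \<exists>es (H :: 'a set). length es = t \<and> p_span p es H \<and> 0 \<in> H \<and> (\<forall>a\<in>H. \<forall>b\<in>H. a + b \<in> H)" for t
  proof (induction t)
    case 0
    show ?case by (intro exI[of _ "[]"] exI[of _ "{0}"]) (simp add: p_span.Nil)
  next
    case (Suc t)
    then obtain es and H :: "'a set" where H: "length es = t" "p_span p es H" "0 \<in> H"
      and plus: "\<And>a b. a \<in> H \<Longrightarrow> b \<in> H \<Longrightarrow> a + b \<in> H" by auto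
    have mult: "of_nat k * a \<in> H" if "a \<in> H" for k a
      by (induction k) (use that H plus in \<open>auto simp: distrib_right\<close>)
    have minus: "a - b \<in> H" if "a \<in> H" "b \<in> H" for a b
    proof -
      have "of_nat (p - 1) = (- 1 :: 'a)" using char p2 by (simp add: of_nat_diff)
      then show ?thesis using plus[OF that(1) mult[OF that(2), of "p - 1"]] by simp
    qed
    have "card H < CARD('a)"
      using p_span_card[OF H(2)] H(1) Suc.prems p2 by (simp add: card)
    then obtain e where e: "e \<notin> H" by (metis UNIV_eq_I less_irrefl)
    have unit: "a \<in> H" if "of_nat k * a \<in> H" "0 < k" "k < p" for k a
    proof -
      have "\<not> p dvd k" using that by (simp add: nat_dvd_not_less)
      then obtain u v where "k * u = Suc (p * v)"
        using bezout_prime[OF p] by metis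
      then have "of_nat (u * k) = (of_nat (Suc (p * v)) :: 'a)"
        by (simp add: mult.commute)
      then have "of_nat (u * k) = (1 :: 'a)"
        by (simp add: char)
      then have "a = of_nat u * (of_nat k * a)"
        by (metis mult.assoc mult_1 of_nat_mult)
      then show ?thesis using mult[OF that(1), of u] by metis
    qed
    have less: False if "h + of_nat k * e = h' + of_nat k' * e" "h \<in> H" "h' \<in> H" "k < k'" "k' < p" for h h' k k'
    proof -
      have "of_nat (k' - k) * e = h - h'"
        using that by (simp add: of_nat_diff algebra_simps)
      then have "of_nat (k' - k) * e \<in> H" using minus that by simp
      moreover have "0 < k' - k" "k' - k < p" using that by auto
      ultimately show False using unit e by blast
    qed
    have inj: "inj_on (\<lambda>(h, k). h + of_nat k * e) (H \<times> {..<p})"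
    proof (rule inj_onI, clarsimp)
      fix h k h' k'
      assume *: "h \<in> H" "k < p" "h' \<in> H" "k' < p" "h + of_nat k * e = h' + of_nat k' * e"
      then have "k = k'"
        using less[of h k h' k'] less[of h' k' h k] by (metis nat_neq_iff)
      with * show "h = h' \<and> k = k'" by simp
    qed
    let ?H = "(\<lambda>(h, k). h + of_nat k * e) ` (H \<times> {..<p})"
    have "a + b \<in> ?H" if a: "a \<in> ?H" and b: "b \<in> ?H" for a b
    proof -
      obtain h k h' k' where *: "h \<in> H" "h' \<in> H" "a = h + of_nat k * e" "b = h' + of_nat k' * e"
        using a b by auto
      then have "a + b = (h + h') + of_nat ((k + k') mod p) * e"
        by (simp add: ofmod algebra_simps)
      then show ?thesis using * plus p2 by (auto intro!: image_eqI[of _ _ "(h + h', (k + k') mod p)"])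
    qed
    moreover have "0 \<in> ?H"
      using H p2 by (auto intro!: image_eqI[of _ _ "(0, 0)"])
    ultimately show ?case
      using p_span.Cons[OF H(2) inj] H(1) by (intro exI[of _ "e # es"] exI[of _ ?H]) auto
  qed
  from this[of s] obtain es and H :: "'a set" where H: "length es = s" "p_span p es H" by auto
  then have "H = UNIV"
    using p_span_card[OF H(2)] card by (intro card_subset_eq) auto
  with H show ?thesis by auto
qed

text \<open>With \<open>E = 1 + \<Delta>\<close> the shift by \<open>a\<close>, the sum of
  \<open>E ^ k\<close> is formally \<open>((1 + \<Delta>) ^ n - 1) / \<Delta>\<close>. For
  \<open>n = p\<close> every coefficient except that of \<open>\<Delta> ^ (p - 1)\<close> is
  divisible by \<open>p\<close>.\<close>

lemma sum_shifts:
  fixes F :: "('n \<Rightarrow> 'a::comm_ring_1) \<Rightarrow> int"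
  shows "(\<Sum>k<n. F (x(i := x i + of_nat k * a)))
    = (\<Sum>j<n. int (n choose Suc j) * pdiffs (replicate j (i, a)) F x)"
proof (induction n arbitrary: F)
  case (Suc n)
  let ?A = "\<lambda>j. pdiffs (replicate j (i, a)) F x"
  \<comment> \<open>Peeling off the first point lets the induction hypothesis act on both
    \<open>F\<close> and its difference; Pascal's rule then recombines the sums.\<close>
  have shift: "F (x(i := x i + of_nat (Suc k) * a))
      = F (x(i := x i + of_nat k * a)) + pdiff (i, a) F (x(i := x i + of_nat k * a))" for k
    by (simp add: pdiff_def algebra_simps)
  have rep: "pdiffs (replicate j (i, a)) (pdiff (i, a) F) x = ?A (Suc j)" for j
    by (simp add: pdiffs_snoc[symmetric] replicate_append_same)
  have "(\<Sum>k<Suc n. F (x(i := x i + of_nat k * a)))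
      = F x + (\<Sum>k<n. F (x(i := x i + of_nat (Suc k) * a)))"
    by (subst sum.lessThan_Suc_shift) simp
  also have "\<dots> = ?A 0 + (\<Sum>j<n. int (n choose Suc j) * ?A j) + (\<Sum>j<n. int (n choose Suc j) * ?A (Suc j))"
    unfolding shift sum.distrib Suc rep by simp
  also have "\<dots> = (\<Sum>j<Suc n. int (n choose Suc j) * ?A j) + (\<Sum>j<Suc n. int (n choose j) * ?A j)"
    by (subst (2) sum.lessThan_Suc_shift) (simp add: binomial_eq_0)
  also have "\<dots> = (\<Sum>j<Suc n. int (Suc n choose Suc j) * ?A j)"
    by (simp only: sum.distrib[symmetric] binomial_Suc_Suc of_nat_add distrib_right add.commute)
  finally show ?case .
qed simp

section \<open>Decay of indicators and of their sums\<close>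

context diff_weights
begin

text \<open>The indicator of the zero set is the coefficient of \<open>0\<close> of \<open>\<epsilon> \<circ> g\<close>, where \<open>\<epsilon> a\<close> is the
  group-like element of \<open>a\<close> in the integral group ring.\<close>

lemma decay_indicator:
  fixes g :: "('n \<Rightarrow> 'a::plus) \<Rightarrow> 'b::comm_ring_1"
  assumes p: "prime p" "of_nat p = (0 :: 'b)" and es: "p_span p es (UNIV :: 'b set)"
    and g: "wdeg_le w g" "w \<ge> 0"
  shows "decay p (w * real (length es)) w (\<lambda>x. of_bool (g x = 0))"
  unfolding decay_def
proof (intro allI impI)
  fix D :: "('n \<times> 'a) list" and x c
  assume D: "D \<in> dirs" "real (p - 1) * (w * real (length es) + real c * w) < W D"
  define \<epsilon> :: "'b \<Rightarrow> 'b \<Rightarrow>\<^sub>0 int" where "\<epsilon> a = Poly_Mapping.single a 1" for a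
  define Y where "Y = (\<lambda>e. \<epsilon> e - 1) ` set es"
  have \<epsilon>: "\<epsilon> (a + b) = \<epsilon> a * \<epsilon> b" "\<epsilon> 0 = 1" for a b
    by (simp_all add: \<epsilon>_def mult_single)
  \<comment> \<open>The augmentation ideal is generated by the basis elements alone, which keeps the
    number of generators at most \<open>length es\<close>.\<close>
  have gen: "\<epsilon> a - 1 \<in> ideal_power Y 1" for a
  proof -
    have "UNIV \<subseteq> {a. \<epsilon> a - 1 \<in> ideal_power Y 1}"
    proof (rule p_span_subset[OF es])
      fix a b assume *: "a \<in> {a. \<epsilon> a - 1 \<in> ideal_power Y 1}" "b \<in> {a. \<epsilon> a - 1 \<in> ideal_power Y 1}"
      have "\<epsilon> (a + b) - 1 = \<epsilon> b * (\<epsilon> a - 1) + (\<epsilon> b - 1)"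
        by (simp add: \<epsilon> algebra_simps)
      then show "a + b \<in> {a. \<epsilon> a - 1 \<in> ideal_power Y 1}"
        using * by (simp only: mem_Collect_eq ideal_power_add ideal_power_cmult)
    next
      show "set es \<subseteq> {a. \<epsilon> a - 1 \<in> ideal_power Y 1}"
        using ideal_power_monomial[of "{#_#}" Y 1 1] by (auto simp: Y_def)
    qed (simp add: \<epsilon> ideal_power.zero)
    then show ?thesis by auto
  qed
  have "real ((p - 1) * (length es + c)) * w < W D"
    using D(2) unfolding of_nat_mult of_nat_add by (simp only: algebra_simps)
  then have mem: "pdiffs D (\<lambda>x. \<epsilon> (g x)) x \<in> ideal_power Y (Suc ((p - 1) * (length es + c)))"
    using pdiffs_exp_mem_ideal_power[OF \<epsilon> gen] g D(1) by blast
  have "of_nat p ^ Suc c dvd pdiffs D (\<lambda>x. \<epsilon> (g x)) x"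
  proof (rule ideal_power_dvd[OF _ _ _ _ mem])
    show "finite Y" "card Y \<le> length es"
      unfolding Y_def using card_image_le[of "set es" "\<lambda>e. \<epsilon> e - 1"] card_length[of es] by auto
    show "1 \<le> p" using p(1) prime_ge_1_nat by blast
    fix y assume "y \<in> Y"
    then obtain e where e: "y = \<epsilon> e - 1" by (auto simp: Y_def)
    have "\<epsilon> e ^ k = \<epsilon> (of_nat k * e)" for k
      by (induction k) (simp_all add: \<epsilon> distrib_right)
    then have "\<epsilon> e ^ p = 1" by (simp add: p(2) \<epsilon>)
    then show "of_nat p * y dvd y ^ p"
      unfolding e by (rule of_nat_prime_mult_dvd_power[OF p(1)])
  qed
  then obtain v where v: "pdiffs D (\<lambda>x. \<epsilon> (g x)) x = of_nat p ^ Suc c * v" ..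
  \<comment> \<open>Taking the coefficient at 0 respects integer multiples, so divisibility descends
    from the group ring to the integers.\<close>
  have "Poly_Mapping.lookup (of_nat n * u) 0 = int n * Poly_Mapping.lookup u 0" for n and u :: "'b \<Rightarrow>\<^sub>0 int"
    by (induction n) (simp_all add: lookup_add distrib_right)
  then have "Poly_Mapping.lookup (of_nat p ^ Suc c * v) 0 = int p ^ Suc c * Poly_Mapping.lookup v 0"
    by (metis of_nat_power)
  moreover have "pdiffs D (\<lambda>x. of_bool (g x = 0)) x = Poly_Mapping.lookup (pdiffs D (\<lambda>x. \<epsilon> (g x)) x) 0"
  proof -
    have "of_bool (a = 0) = Poly_Mapping.lookup (\<epsilon> a) 0" for a
      by (simp add: \<epsilon>_def lookup_single when_def)
    then show ?thesis
      by (simp add: pdiffs_additive[where \<phi> = "\<lambda>u. Poly_Mapping.lookup u 0"] lookup_minus)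
  qed
  ultimately show "int p ^ Suc c dvd pdiffs D (\<lambda>x. of_bool (g x = 0)) x"
    by (simp add: v)
qed

text \<open>The top term of \<open>sum_shifts\<close> carries \<open>p - 1\<close> extra differences
  of weight \<open>\<omega> i\<close>. Every other term has a binomial factor \<open>p\<close>,
  worth \<open>M\<close> units of threshold, which suffices as
  \<open>\<omega> i \<le> M\<close>.\<close>

lemma decay_sum_shifts:
  fixes F :: "('n \<Rightarrow> 'a::comm_ring_1) \<Rightarrow> int"
  assumes F: "decay p R M F" and p: "prime p" and i: "i \<in> I" "\<omega> i \<le> M"
  shows "decay p (R - \<omega> i) M (\<lambda>x. \<Sum>k<p. F (x(i := x i + of_nat k * a)))"
  unfolding decay_def
proof (intro allI impI)
  fix D :: "('n \<times> 'a) list" and x c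
  assume D: "D \<in> dirs" "real (p - 1) * (R - \<omega> i + real c * M) < W D"
  have p2: "p \<ge> 2" using p prime_ge_2_nat by blast
  have dirs: "D @ replicate j (i, a) \<in> dirs" for j
    using D i dirs_replicate[of "(i, a)"] by simp
  have "int p ^ Suc c dvd int (p choose Suc j) * pdiffs (D @ replicate j (i, a)) F x" if j: "j < p" for j
  proof (cases "Suc j = p")
    case True
    then have "real (p - 1) * (R + real c * M) < W (D @ replicate j (i, a))"
      using D(2) by (auto simp: algebra_simps)
    from decayD[OF F dirs this, of x] True show ?thesis by simp
  next
    case False
    then have "p dvd (p choose Suc j)"
      using j p by (intro dvd_choose_prime) auto
    then have 1: "int p dvd int (p choose Suc j)" by simp
    have 2: "int p ^ c dvd pdiffs (D @ replicate j (i, a)) F x"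
    proof (cases c)
      case (Suc c')
      have "real (p - 1) * (R + real c' * M) \<le> real (p - 1) * (R - \<omega> i + real c * M)"
        using i by (intro mult_left_mono) (auto simp: Suc algebra_simps)
      also have "\<dots> < W D" by fact
      also have "\<dots> \<le> W (D @ replicate j (i, a))"
        using weight_pos[OF i(1)] by simp
      finally show ?thesis using decayD[OF F dirs] Suc by blast
    qed simp
    show ?thesis using mult_dvd_mono[OF 1 2] by simp
  qed
  then show "int p ^ Suc c dvd pdiffs D (\<lambda>x. \<Sum>k<p. F (x(i := x i + of_nat k * a))) x"
    by (auto simp: sum_shifts pdiffs_sum pdiffs_cmult pdiffs_append intro!: dvd_sum)
qed

lemma decay_sum_p_span:
  fixes F :: "('n \<Rightarrow> 'a::comm_ring_1) \<Rightarrow> int"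
  assumes "p_span p es H" and F: "decay p R M F" and p: "prime p" and i: "i \<in> I" "\<omega> i \<le> M"
  shows "decay p (R - real (length es) * \<omega> i) M (\<lambda>x. \<Sum>a\<in>H. F (x(i := x i + a)))"
  using assms(1) F
proof (induction arbitrary: R F rule: p_span.induct)
  case (Cons es H e)
  have "(\<Sum>b\<in>(\<lambda>(h, k). h + of_nat k * e) ` (H \<times> {..<p}). F (x(i := x i + b)))
      = (\<Sum>h\<in>H. \<Sum>k<p. F ((x(i := x i + h))(i := (x(i := x i + h)) i + of_nat k * e)))" for x
    by (subst sum.reindex[OF Cons.hyps(2)])
       (simp add: sum.cartesian_product case_prod_unfold add.assoc)
  moreover have "R - \<omega> i - real (length es) * \<omega> i = R - real (length (e # es)) * \<omega> i"
    by (simp add: algebra_simps)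
  ultimately show ?case
    using Cons.IH[OF decay_sum_shifts[OF Cons.prems p i, of e]] by (simp only:)
qed simp

text \<open>The partial sum remains a function of \<open>y\<close>, so coordinates can be summed one
  at a time, each lowering the threshold by \<open>length es * \<omega> i\<close>.\<close>

lemma decay_sum_coords:
  fixes F :: "('n \<Rightarrow> 'a::{comm_ring_1,finite}) \<Rightarrow> int"
  assumes es: "p_span p es (UNIV :: 'a set)" and F: "decay p R M F" and p: "prime p"
    and J: "finite J" "J \<subseteq> I" "\<And>i. i \<in> J \<Longrightarrow> \<omega> i \<le> M" and fin: "finite (UNIV :: 'n set)"
  shows "decay p (R - real (length es) * (\<Sum>i\<in>J. \<omega> i)) M (\<lambda>y. \<Sum>x | \<forall>k. k \<notin> J \<longrightarrow> x k = y k. F x)"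
  using J
proof (induction J rule: finite_induct)
  case empty
  have "{x. \<forall>k. x k = y k} = {y}" for y :: "'n \<Rightarrow> 'a" by auto
  then show ?case using F by simp
next
  case (insert i J)
  have "finite (UNIV :: ('n \<Rightarrow> 'a) set)"
    using fin by (simp add: finite_UNIV_fun)
  then have fin': "finite X" for X :: "('n \<Rightarrow> 'a) set"
    by (rule finite_subset[rotated]) simp
  have "(\<Sum>x | \<forall>k. k \<notin> insert i J \<longrightarrow> x k = y k. F x)
      = (\<Sum>a\<in>UNIV. \<Sum>x | \<forall>k. k \<notin> J \<longrightarrow> x k = (y(i := y i + a)) k. F x)" for y
  proof -
    have "{x. \<forall>k. k \<notin> insert i J \<longrightarrow> x k = y k}
        = (\<Union>a\<in>UNIV. {x. \<forall>k. k \<notin> J \<longrightarrow> x k = (y(i := y i + a)) k})" (is "_ = ?U")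
    proof (intro set_eqI iffI)
      fix x assume "x \<in> {x. \<forall>k. k \<notin> insert i J \<longrightarrow> x k = y k}"
      then show "x \<in> ?U"
        using insert.hyps by (auto intro!: exI[of _ "x i - y i"])
    qed (auto split: if_splits)
    also have "sum F ?U = (\<Sum>a\<in>UNIV. \<Sum>x | \<forall>k. k \<notin> J \<longrightarrow> x k = (y(i := y i + a)) k. F x)"
    proof (rule sum.UNION_disjoint)
      show "\<forall>a\<in>UNIV. \<forall>b\<in>UNIV. a \<noteq> b \<longrightarrow>
          {x. \<forall>k. k \<notin> J \<longrightarrow> x k = (y(i := y i + a)) k} \<inter> {x. \<forall>k. k \<notin> J \<longrightarrow> x k = (y(i := y i + b)) k} = {}"
      proof (intro ballI impI equals0I)
        fix a b x assume ab: "a \<noteq> b"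
          and x: "x \<in> {x. \<forall>k. k \<notin> J \<longrightarrow> x k = (y(i := y i + a)) k} \<inter> {x. \<forall>k. k \<notin> J \<longrightarrow> x k = (y(i := y i + b)) k}"
        from x insert.hyps(2) have "x i = y i + a" "x i = y i + b" by auto
        with ab show False by simp
      qed
    qed (use fin' in auto)
    finally show ?thesis .
  qed
  moreover have "decay p (R - real (length es) * (\<Sum>i\<in>J. \<omega> i)) M (\<lambda>y. \<Sum>x | \<forall>k. k \<notin> J \<longrightarrow> x k = y k. F x)"
    using insert by auto
  from decay_sum_p_span[OF es this p, of i] insert
  have "decay p (R - real (length es) * (\<Sum>i\<in>J. \<omega> i) - real (length es) * \<omega> i) M
      (\<lambda>y. \<Sum>a\<in>UNIV. \<Sum>x | \<forall>k. k \<notin> J \<longrightarrow> x k = (y(i := y i + a)) k. F x)" by auto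
  ultimately show ?case
    using insert.hyps by (simp add: algebra_simps)
qed

lemma decay_sum_UNIV_dvd:
  fixes F :: "('n \<Rightarrow> 'a::{comm_ring_1,finite}) \<Rightarrow> int"
  assumes es: "p_span p es (UNIV :: 'a set)" and F: "decay p R M F" and p: "prime p"
    and I: "\<And>i. i \<in> I \<Longrightarrow> \<omega> i \<le> M" and fin: "finite (UNIV :: 'n set)"
    and c: "R + real c * M < real (length es) * (\<Sum>i\<in>I. \<omega> i)"
  shows "int p ^ Suc c dvd (\<Sum>x\<in>UNIV. F x)"
proof -
  have "finite (UNIV :: ('n \<Rightarrow> 'a) set)"
    using fin by (simp add: finite_UNIV_fun)
  then have fin': "finite X" for X :: "('n \<Rightarrow> 'a) set"
    by (rule finite_subset[rotated]) simp
  have finI: "finite I" using fin by (rule finite_subset[rotated]) simp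
  have "real (p - 1) > 0" using prime_gt_1_nat[OF p] by simp
  \<comment> \<open>The threshold has become negative, so even the empty list of differences exceeds
    it and the values themselves are divisible.\<close>
  then have "real (p - 1) * (R - real (length es) * (\<Sum>i\<in>I. \<omega> i) + real c * M) < 0"
    using c by (intro mult_pos_neg) auto
  then have dvd: "int p ^ Suc c dvd (\<Sum>x | \<forall>k. k \<notin> I \<longrightarrow> x k = y k. F x)" for y
    using decayD[OF decay_sum_coords[OF es F p finI subset_refl I fin], of "[]" c y]
    unfolding pdiffs_Nil W_simps(1) by (simp only: dirs_simps(1))
  \<comment> \<open>Each fibre has a unique representative vanishing on \<open>I\<close>; the
    divisible fibre sums are then simply added.\<close>
  have UN: "UNIV = (\<Union>y\<in>{y. \<forall>k\<in>I. y k = 0}. {x :: 'n \<Rightarrow> 'a. \<forall>k. k \<notin> I \<longrightarrow> x k = y k})" (is "_ = ?U")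
  proof (intro set_eqI iffI)
    fix x :: "'n \<Rightarrow> 'a"
    show "x \<in> ?U" by (auto intro!: exI[of _ "\<lambda>k. if k \<in> I then 0 else x k"])
  qed simp
  have "sum F ?U = (\<Sum>y | \<forall>k\<in>I. y k = 0. \<Sum>x | \<forall>k. k \<notin> I \<longrightarrow> x k = y k. F x)"
  proof (rule sum.UNION_disjoint)
    show "\<forall>y\<in>{y. \<forall>k\<in>I. y k = 0}. \<forall>z\<in>{y. \<forall>k\<in>I. y k = 0}. y \<noteq> z \<longrightarrow>
        {x :: 'n \<Rightarrow> 'a. \<forall>k. k \<notin> I \<longrightarrow> x k = y k} \<inter> {x. \<forall>k. k \<notin> I \<longrightarrow> x k = z k} = {}"
      by (auto simp: fun_eq_iff) metis
  qed (use fin' in auto)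
  then show ?thesis
    using dvd unfolding UN[symmetric] by (simp only: dvd_sum)
qed

end

section \<open>Weights of polynomials and the divisibility theorem\<close>

text \<open>Translation by 1 permutes the ring, hence preserves the sum of all elements.\<close>

lemma of_nat_CARD_eq_0: "of_nat CARD('a) = (0 :: 'a::{ring_1,finite})"
proof -
  have "(\<Sum>x\<in>(UNIV :: 'a set). x + 1) = (\<Sum>x\<in>UNIV. x)"
    by (rule sum.reindex_bij_witness[of _ "\<lambda>x. x - 1" "\<lambda>x. x + 1"]) auto
  then show ?thesis by (simp add: sum.distrib)
qed

lemma digit_sum_pos: "N \<ge> 2 \<Longrightarrow> M > 0 \<Longrightarrow> digit_sum N M > 0"
proof (induction M rule: less_induct)
  case (less M)
  show ?case
  proof (cases "M mod N = 0")
    case True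
    then have "M div N > 0" using less.prems by (auto simp: div_greater_zero_iff intro: dvd_imp_le)
    moreover have "M div N < M" using less.prems by simp
    ultimately show ?thesis
      using less by (subst digit_sum.simps) auto
  qed (use less.prems in \<open>subst digit_sum.simps, auto\<close>)
qed

lemma finite_coeff_support: "finite {m. coeff f m \<noteq> 0}"
  by (rule finite_subset[of _ "{..degree f}"]) (auto intro: le_degree)

lemma digit_sum_le_poly_weight: "coeff f m \<noteq> 0 \<Longrightarrow> digit_sum p m \<le> poly_weight p f"
  unfolding poly_weight_def using finite_coeff_support[of f] by (intro Max_ge) auto

lemma monom_weight_le_mvpoly_weight:
  "m \<in> Poly_Mapping.keys P \<Longrightarrow> monom_weight p I m \<le> mvpoly_weight p I P"
  unfolding mvpoly_weight_def by (intro Max_ge) auto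

context diff_weights
begin

lemma wdeg_le_poly:
  fixes f :: "'a::comm_ring_1 poly"
  assumes p: "prime p" "p = CHAR('a)" and i: "i \<in> I"
  shows "wdeg_le (\<omega> i * real (poly_weight p f)) (\<lambda>x. poly f (x i))"
proof -
  have nonneg: "\<omega> i \<ge> 0" using weight_pos[OF i] by simp
  have "wdeg_le (\<omega> i * real (poly_weight p f)) (\<lambda>x. coeff f m * x i ^ m)" for m
  proof (cases "coeff f m = 0")
    case False
    have "wdeg_le (0 + \<omega> i * real (digit_sum p m)) (\<lambda>x. coeff f m * x i ^ m)"
      by (intro wdeg_le_mult wdeg_le_const wdeg_le_power_digit_sum p wdeg_le_coord i nonneg order_refl)
    then show ?thesis
      by (rule wdeg_le_mono) (simp add: digit_sum_le_poly_weight[OF False] mult_left_mono nonneg)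
  qed (use nonneg in \<open>simp add: wdeg_le_const\<close>)
  then have "wdeg_le (\<omega> i * real (poly_weight p f)) (\<lambda>x. \<Sum>m\<le>degree f. coeff f m * x i ^ m)"
    by (rule wdeg_le_sum)
  then show ?thesis by (simp add: poly_altdef)
qed

text \<open>Meant for \<open>g i x = poly (f i) (x i)\<close>: the choice of \<open>\<omega>\<close>
  normalises these to degree at most 1 on \<open>J\<close>, so only digit sums of exponents in
  \<open>J\<close> count.\<close>

lemma wdeg_le_mvpoly_eval:
  fixes P :: "('v::finite, 'a::comm_ring_1) mvpoly" and g :: "'v \<Rightarrow> ('n \<Rightarrow> 'a) \<Rightarrow> 'a"
  assumes p: "prime p" "p = CHAR('a)"
    and g: "\<And>i. i \<in> J \<Longrightarrow> wdeg_le 1 (g i)" "\<And>i. i \<notin> J \<Longrightarrow> wdeg_le 0 (g i)"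
  shows "wdeg_le (real (mvpoly_weight p J P)) (\<lambda>x. mvpoly_eval P (\<lambda>i. g i x))"
  unfolding mvpoly_eval_def
proof (rule wdeg_le_sum)
  fix m assume m: "m \<in> Poly_Mapping.keys P"
  let ?w = "\<lambda>i. (if i \<in> J then 1 else 0) * real (digit_sum p (Poly_Mapping.lookup m i))"
  have "wdeg_le (\<Sum>i\<in>UNIV. ?w i) (\<lambda>x. \<Prod>i\<in>UNIV. g i x ^ Poly_Mapping.lookup m i)"
    using g by (intro wdeg_le_prod wdeg_le_power_digit_sum p) auto
  also have "(\<Sum>i\<in>UNIV. ?w i) = real (monom_weight p J m)"
    by (simp add: monom_weight_def if_distrib[of "\<lambda>c. c * _"] sum.If_cases cong: if_cong)
  finally have "wdeg_le (0 + real (monom_weight p J m)) (\<lambda>x. Poly_Mapping.lookup P m * (\<Prod>i\<in>UNIV. g i x ^ Poly_Mapping.lookup m i))"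
    by (intro wdeg_le_mult wdeg_le_const order_refl)
  then show "wdeg_le (real (mvpoly_weight p J P)) (\<lambda>x. Poly_Mapping.lookup P m * (\<Prod>i\<in>UNIV. g i x ^ Poly_Mapping.lookup m i))"
    by (rule wdeg_le_mono) (use monom_weight_le_mvpoly_weight[OF m] in simp)
qed

end

theorem theorem1p18:
  fixes P :: "nat \<Rightarrow> ('n::finite, 'a::{field,finite}) mvpoly"
    and f :: "'n \<Rightarrow> 'a poly"
    and I :: "'n set"
    and p s r :: nat
  assumes "prime p"
    and "CARD('a) = p ^ s"
    and "r \<ge> 1"
    and "\<And>j. j \<in> {1..r} \<Longrightarrow> P j \<noteq> 0"
    and "I \<noteq> {}"
    and "(MAX j\<in>{1..r}. mvpoly_weight p I (P j)) > 0"
    and "\<And>i. i \<in> I \<Longrightarrow> degree (f i) > 0"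
    and "real (\<Sum>j=1..r. mvpoly_weight p I (P j)) \<le> (\<Sum>i\<in>I. 1 / real (poly_weight p (f i)))"
  shows "p ^ nat \<lceil>real s * ((\<Sum>i\<in>I. 1 / real (poly_weight p (f i)))
                             - real (\<Sum>j=1..r. mvpoly_weight p I (P j)))
                   / real (MAX j\<in>{1..r}. mvpoly_weight p I (P j))\<rceil>
         dvd card {x :: 'n \<Rightarrow> 'a. \<forall>j\<in>{1..r}. mvpoly_eval (P j) (\<lambda>i. poly (f i) (x i)) = 0}"
proof -
  have p2: "p \<ge> 2" using prime_ge_2_nat[OF assms(1)] .
  have "(of_nat p :: 'a) ^ s = 0"
    using of_nat_CARD_eq_0[where ?'a = 'a] assms(2) by simp
  then have p0: "of_nat p = (0 :: 'a)" by simp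
  then have "CHAR('a) dvd p" by (simp add: of_nat_eq_0_iff_char_dvd)
  moreover have "CHAR('a) \<noteq> 1"
    using of_nat_CHAR[where ?'a = 'a] by (metis of_nat_1 zero_neq_one)
  ultimately have char: "p = CHAR('a)"
    using assms(1) by (auto simp: prime_nat_iff)
  obtain es where es: "length es = s" "p_span p es (UNIV :: 'a set)"
    using ex_p_span[OF assms(1) p0 assms(2)] by blast

  define \<omega> where "\<omega> i = 1 / real (poly_weight p (f i))" for i
  define w where "w j = mvpoly_weight p I (P j)" for j
  define M where "M = (MAX j\<in>{1..r}. w j)"
  \<comment> \<open>Nonconstancy gives a positive leading exponent, hence a positive digit sum. It
    follows that \<open>\<omega> i\<close> is positive and at most 1.\<close>
  have weight: "poly_weight p (f i) \<ge> 1" if "i \<in> I" for i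
  proof -
    have "digit_sum p (degree (f i)) \<le> poly_weight p (f i)"
      using assms(7)[OF that] by (intro digit_sum_le_poly_weight) auto
    then show ?thesis
      using digit_sum_pos[OF p2 assms(7)[OF that]] by simp
  qed
  interpret diff_weights I \<omega>
    by standard (use weight in \<open>force simp: \<omega>_def\<close>)

  define g where "g j x = mvpoly_eval (P j) (\<lambda>i. poly (f i) (x i))" for j x
  have g: "wdeg_le (real (w j)) (g j)" for j
    unfolding g_def w_def
  proof (rule wdeg_le_mvpoly_eval[OF assms(1) char])
    fix i assume i: "i \<in> I"
    then show "wdeg_le 1 (\<lambda>x. poly (f i) (x i))"
      using wdeg_le_poly[OF assms(1) char i, of "f i"] weight[OF i] by (simp add: \<omega>_def)
  next
    fix i assume "i \<notin> I"
    then show "wdeg_le 0 (\<lambda>x. poly (f i) (x i))"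
      by (intro wdeg_le_invariant) auto
  qed
  have M: "M > 0" using assms(6) by (simp add: M_def w_def)
  have wM: "w j \<le> M" if "j \<in> {1..r}" for j
    unfolding M_def using that by (intro Max_ge) auto
  have "decay p (\<Sum>j\<in>{1..r}. real (w j) * real s) (real M) (\<lambda>x. \<Prod>j\<in>{1..r}. of_bool (g j x = 0))"
  proof (rule decay_prod)
    fix j assume j: "j \<in> {1..r}"
    have "decay p (real (w j) * real s) (real (w j)) (\<lambda>x. of_bool (g j x = 0))"
      using decay_indicator[OF assms(1) p0 es(2) g] es(1) by simp
    then show "decay p (real (w j) * real s) (real M) (\<lambda>x. of_bool (g j x = 0))"
      by (rule decay_mono) (use wM[OF j] in simp)
  qed (use M p2 in auto)
  note dvd = decay_sum_UNIV_dvd[OF es(2) this assms(1)]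

  let ?S = "{x :: 'n \<Rightarrow> 'a. \<forall>j\<in>{1..r}. g j x = 0}"
  have "(\<Prod>j\<in>{1..r}. of_bool (g j x = 0)) = (of_bool (x \<in> ?S) :: int)" for x
  proof (cases "x \<in> ?S")
    case False
    then obtain j where "j \<in> {1..r}" "g j x \<noteq> 0" by blast
    then have "(\<Prod>j\<in>{1..r}. of_bool (g j x = 0)) = (0 :: int)"
      by (intro prod_zero) auto
    with False show ?thesis by simp
  qed simp
  then have count: "(\<Sum>x\<in>UNIV. \<Prod>j\<in>{1..r}. of_bool (g j x = 0)) = int (card ?S)"
    by (simp add: sum.If_cases of_bool_def)
  define t where "t = real s * ((\<Sum>i\<in>I. \<omega> i) - real (\<Sum>j\<in>{1..r}. w j)) / real M"
  have "p ^ nat \<lceil>t\<rceil> dvd card ?S"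
  proof (cases "nat \<lceil>t\<rceil>")
    case (Suc c)
    \<comment> \<open>Rounding up: an exponent \<open>Suc c\<close> means exactly that
      \<open>c\<close> lies strictly below \<open>t\<close>, the strict inequality that
      \<open>dvd\<close> requires.\<close>
    then have "real c < t" by linarith
    then have "(\<Sum>j\<in>{1..r}. real (w j) * real s) + real c * real M < real (length es) * (\<Sum>i\<in>I. \<omega> i)"
      using M by (simp add: t_def es(1) field_simps sum_distrib_left)
    \<comment> \<open>Here \<open>M\<close> is a positive integer, so it is at least 1.\<close>
    moreover have "\<omega> i \<le> real M" if "i \<in> I" for i
    proof -
      have "\<omega> i \<le> 1" using weight[OF that] by (simp add: \<omega>_def)
      also have "\<dots> \<le> real M" using M by simp
      finally show ?thesis .
    qed
    ultimately have "int p ^ Suc c dvd int (card ?S)"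
      using dvd[of c] unfolding count by simp
    then have "p ^ Suc c dvd card ?S"
      by (simp only: of_nat_power[symmetric] of_nat_dvd_iff)
    then show ?thesis by (simp add: Suc)
  qed simp
  then show ?thesis
    by (simp only: t_def \<omega>_def w_def M_def g_def)
qed

end
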